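(* With the binary operation $(X,Y)\mapsto X\otimes Y$ the $\mathcal V$-category $\mathcal GH=(\mathcal G,GH)$ becomes a monoid in the monoidal category $\mathcal V\text{-}\mathsf{CAT}$.
   Context: $\mathcal V$ is a commutative unital quantale: a complete lattice with a commutative, associative operation $\otimes$ with neutral element $k$, such that $\otimes$ preserves arbitrary suprema in each variable; it is assumed that $k>\bot$. A $\mathcal V$-category $X=(X,a)$ is a set $X$ with $a:X\times X\to\mathcal V$ satisfying $k\le a(x,x)$ and $a(x,y)\otimes a(y,z)\le a(x,z)$. A $\mathcal V$-functor $f:(X,a)\to(Y,b)$ is a map with $a(x,y)\le b(f(x),f(y))$. $\mathcal V\text{-}\mathsf{Cat}$ is the category of small, $\mathcal V\text{-}\mathsf{CAT}$ that of possibly large, $\mathcal V$-categories and $\mathcal V$-functors. Both are monoidal with $(X,a)\otimes(Y,b)=(X\times Y,a\otimes b)$, $(a\otimes b)((x,y),(x',y'))=a(x,x')\otimes b(y,y')$, and unit $E=(\{*\},k)$. A $\mathcal V$-module $\varphi:X\to Y$ between $(X,a)$ and $(Y,b)$ is a function $\varphi:X\times Y\to\mathcal V$ with $a(x',x)\otimes\varphi(x,y)\le\varphi(x',y)$ and $\varphi(x,y)\otimes b(y,y')\le\varphi(x,y')$. For $A\subseteq X$, $B\subseteq Y$ one has $\tilde H\varphi(A,B)=\bigwedge_{x\in A}\bigvee_{y\in B}\varphi(x,y)$. $\mathcal G=\mathrm{ob}(\mathcal V\text{-}\mathsf{Cat})/\!\cong$ is the class of isomorphism classes of $\mathcal V$-categories,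 with the (large) $\mathcal V$-category structure $GH(X,Y)=\bigvee_{\varphi:X\to Y}\tilde H\varphi(X,Y)$, the join ranging over all $\mathcal V$-modules $\varphi:X\to Y$. *)

theory Defs
  imports "HOL-Library.Equipollence"
begin

section \<open>Quantales\<close>

(* A commutative unital quantale whose tensor is written x * y and whose neutral element k is
   written 1.  Preservation of suprema in the first variable follows by commutativity. *)
class comm_quantale = complete_lattice + comm_monoid_mult +
  assumes mult_Sup: "x * Sup A = (SUP y\<in>A. x * y)"
    and bot_less_one: "bot < 1"

section \<open>\<V>-categories, \<V>-functors, \<V>-modules\<close>

(* Only the values of hom on the carrier ob are relevant. *)
record ('a, 'v) vcat =
  ob :: "'a set"
  hom :: "'a \<Rightarrow> 'a \<Rightarrow> 'v"

definition vcategory :: "('a, 'v::comm_quantale) vcat \<Rightarrow> bool" where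
  "vcategory X \<longleftrightarrow>
     (\<forall>x\<in>ob X. 1 \<le> hom X x x) \<and>
     (\<forall>x\<in>ob X. \<forall>y\<in>ob X. \<forall>z\<in>ob X. hom X x y * hom X y z \<le> hom X x z)"

definition vfunctor :: "('a, 'v::comm_quantale) vcat \<Rightarrow> ('b, 'v) vcat \<Rightarrow> ('a \<Rightarrow> 'b) \<Rightarrow> bool" where
  "vfunctor X Y f \<longleftrightarrow>
     (\<forall>x\<in>ob X. f x \<in> ob Y) \<and>
     (\<forall>x\<in>ob X. \<forall>y\<in>ob X. hom X x y \<le> hom Y (f x) (f y))"

definition viso :: "('a, 'v::comm_quantale) vcat \<Rightarrow> ('b, 'v) vcat \<Rightarrow> bool" where
  "viso X Y \<longleftrightarrow> (\<exists>f g. vfunctor X Y f \<and> vfunctor Y X g \<and>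
     (\<forall>x\<in>ob X. g (f x) = x) \<and> (\<forall>y\<in>ob Y. f (g y) = y))"

definition vtensor ::
    "('a, 'v::comm_quantale) vcat \<Rightarrow> ('b, 'v) vcat \<Rightarrow> ('a \<times> 'b, 'v) vcat" where
  "vtensor X Y = \<lparr>ob = ob X \<times> ob Y,
     hom = (\<lambda>p q. hom X (fst p) (fst q) * hom Y (snd p) (snd q))\<rparr>"

definition vunit :: "(unit, 'v::comm_quantale) vcat" where
  "vunit = \<lparr>ob = {()}, hom = (\<lambda>_ _. 1)\<rparr>"

definition vmodule ::
    "('a, 'v::comm_quantale) vcat \<Rightarrow> ('b, 'v) vcat \<Rightarrow> ('a \<Rightarrow> 'b \<Rightarrow> 'v) \<Rightarrow> bool" where
  "vmodule X Y \<phi> \<longleftrightarrow>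
     (\<forall>x'\<in>ob X. \<forall>x\<in>ob X. \<forall>y\<in>ob Y. hom X x' x * \<phi> x y \<le> \<phi> x' y) \<and>
     (\<forall>x\<in>ob X. \<forall>y\<in>ob Y. \<forall>y'\<in>ob Y. \<phi> x y * hom Y y y' \<le> \<phi> x y')"

definition Htilde :: "('a \<Rightarrow> 'b \<Rightarrow> 'v::comm_quantale) \<Rightarrow> 'a set \<Rightarrow> 'b set \<Rightarrow> 'v" where
  "Htilde \<phi> A B = (INF x\<in>A. SUP y\<in>B. \<phi> x y)"

definition GH :: "('a, 'v::comm_quantale) vcat \<Rightarrow> ('b, 'v) vcat \<Rightarrow> 'v" where
  "GH X Y = (SUP \<phi>\<in>{\<phi>. vmodule X Y \<phi>}. Htilde \<phi> (ob X) (ob Y))"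

section \<open>Monoids in the monoidal category of large \<V>-categories\<close>

(* A large V-category is a V-category over an arbitrary type.  The tensor of morphisms is
   map_prod; the associativity isomorphism is ((x,y),z) |-> (x,(y,z)), and the left and right
   unit isomorphisms are the projections snd and fst.  Parallel morphisms are equal iff they
   agree on the objects of their domain. *)
definition vassoc :: "('a \<times> 'b) \<times> 'c \<Rightarrow> 'a \<times> ('b \<times> 'c)" where
  "vassoc p = (fst (fst p), (snd (fst p), snd p))"

definition monoid_in_VCAT ::
    "('a, 'v::comm_quantale) vcat \<Rightarrow> ('a \<times> 'a \<Rightarrow> 'a) \<Rightarrow> (unit \<Rightarrow> 'a) \<Rightarrow> bool" where
  "monoid_in_VCAT M \<mu> \<eta> \<longleftrightarrow>
     vcategory M \<and>
     vfunctor (vtensor M M) M \<mu> \<and>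
     vfunctor vunit M \<eta> \<and>
     (\<forall>p\<in>ob (vtensor (vtensor M M) M).
        (\<mu> \<circ> map_prod \<mu> id) p = (\<mu> \<circ> map_prod id \<mu> \<circ> vassoc) p) \<and>
     (\<forall>p\<in>ob (vtensor vunit M). (\<mu> \<circ> map_prod \<eta> id) p = snd p) \<and>
     (\<forall>p\<in>ob (vtensor M vunit). (\<mu> \<circ> map_prod id \<eta>) p = fst p)"

section \<open>Smallness and the large \<V>-category \<open>\<G>H\<close>\<close>

(* HOL has no set of all sets, so the universe of small sets is a parameter: a family of subsets
   of an arbitrary type 'u, closed (up to bijection) under the constructions needed here.  With 'u
   a type of all ZFC sets it can be the family of ZF-small subsets; with 'u any
   infinite type it can be the family of all subsets, or of those of cardinality
   below a fixed infinite cardinal. *)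
definition universe :: "('u set \<Rightarrow> bool) \<Rightarrow> bool" where
  "universe small \<longleftrightarrow>
     (\<exists>A. small A \<and> A \<noteq> {}) \<and>
     (\<forall>A B. small A \<and> B \<lesssim> A \<longrightarrow> small B) \<and>
     (\<forall>A B. small A \<and> small B \<longrightarrow> (\<exists>C. small C \<and> C \<approx> A \<times> B))"

definition small_vcat :: "('u set \<Rightarrow> bool) \<Rightarrow> ('u, 'v::comm_quantale) vcat \<Rightarrow> bool" where
  "small_vcat small X \<longleftrightarrow> small (ob X) \<and> vcategory X"

(* X may live on another type: this is how the classes of tensor products and of E are formed. *)
definition iso_class ::
    "('u set \<Rightarrow> bool) \<Rightarrow> ('a, 'v::comm_quantale) vcat \<Rightarrow> ('u, 'v) vcat set" where
  "iso_class small X = {Z. small_vcat small Z \<and> viso Z X}"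

(* The structure of GH on classes, and likewise the tensor of two classes, is formed over all
   representatives; see GH_iso_class and tensor_iso_class below for independence of the choice. *)
definition GH_vcat :: "('u set \<Rightarrow> bool) \<Rightarrow> (('u, 'v::comm_quantale) vcat set, 'v) vcat" where
  "GH_vcat small = \<lparr>ob = {iso_class small X | X :: ('u, 'v) vcat. small_vcat small X},
     hom = (\<lambda>C D. SUP X\<in>C. SUP Y\<in>D. GH X Y)\<rparr>"

definition class_tensor :: "('u set \<Rightarrow> bool) \<Rightarrow>
    ('u, 'v::comm_quantale) vcat set \<times> ('u, 'v) vcat set \<Rightarrow> ('u, 'v) vcat set" where
  "class_tensor small p = (\<Union>X\<in>fst p. \<Union>Y\<in>snd p. iso_class small (vtensor X Y))"

definition class_unit :: "('u set \<Rightarrow> bool) \<Rightarrow> unit \<Rightarrow> ('u, 'v::comm_quantale) vcat set" where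
  "class_unit small u = iso_class small vunit"

section \<open>Well-definedness\<close>

lemma universe_all:
  assumes "infinite (UNIV :: 'u set)"
  shows "universe (\<lambda>_ :: 'u set. True)"
proof -
  obtain h :: "'u \<times> 'u \<Rightarrow> 'u" where h: "bij_betw h (UNIV \<times> UNIV) UNIV"
    using card_of_Times_same_infinite[OF assms] card_of_ordIso by (metis (no_types))
  have "\<exists>C :: 'u set. C \<approx> A \<times> B" for A B :: "'u set"
    by (rule exI[of _ "h ` (A \<times> B)"], rule inj_on_image_eqpoll_self,
        rule inj_on_subset[OF bij_betw_imp_inj_on[OF h]]) simp
  moreover have "\<exists>A :: 'u set. A \<noteq> {}" by (rule exI[of _ UNIV]) simp
  ultimately show ?thesis unfolding universe_def by simp
qed

lemma mult_mono_quantale: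
  fixes a b c d :: "'v::comm_quantale"
  assumes "a \<le> b" "c \<le> d"
  shows "a * c \<le> b * d"
proof -
  have *: "x * y \<le> x * z" if "y \<le> z" for x y z :: 'v
  proof -
    have "x * z = x * Sup {y, z}" using that by (simp add: sup.absorb2)
    also have "\<dots> = sup (x * y) (x * z)" by (subst mult_Sup) simp
    finally show ?thesis by (metis sup_ge1)
  qed
  show ?thesis using *[OF assms(1), of c] *[OF assms(2), of b] by (metis mult.commute order_trans)
qed

lemma vcategory_vtensor:
  "vcategory X \<Longrightarrow> vcategory Y \<Longrightarrow> vcategory (vtensor X Y)"
  unfolding vcategory_def vtensor_def
proof (clarsimp, intro conjI ballI)
  fix a b
  assume "\<forall>x\<in>ob X. 1 \<le> hom X x x" "\<forall>x\<in>ob Y. 1 \<le> hom Y x x" "a \<in> ob X" "b \<in> ob Y"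
  then show "1 \<le> hom X a a * hom Y b b"
    using mult_mono_quantale[of 1 "hom X a a" 1 "hom Y b b"] by simp
next
  fix a b a' b' a'' b''
  assume X: "\<forall>x\<in>ob X. \<forall>y\<in>ob X. \<forall>z\<in>ob X. hom X x y * hom X y z \<le> hom X x z"
    and Y: "\<forall>x\<in>ob Y. \<forall>y\<in>ob Y. \<forall>z\<in>ob Y. hom Y x y * hom Y y z \<le> hom Y x z"
    and "a \<in> ob X" "b \<in> ob Y" "a' \<in> ob X" "b' \<in> ob Y" "a'' \<in> ob X" "b'' \<in> ob Y"
  then have "(hom X a a' * hom X a' a'') * (hom Y b b' * hom Y b' b'') \<le> hom X a a'' * hom Y b b''"
    by (intro mult_mono_quantale) blast+
  then show "hom X a a' * hom Y b b' * (hom X a' a'' * hom Y b' b'') \<le> hom X a a'' * hom Y b b''"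
    by (simp add: ac_simps)
qed

lemma viso_refl: "viso X X"
  unfolding viso_def vfunctor_def by (rule exI[of _ id], rule exI[of _ id]) simp

lemma viso_sym: "viso X Y \<Longrightarrow> viso Y X"
  unfolding viso_def by blast

lemma vfunctor_comp: "vfunctor X Y f \<Longrightarrow> vfunctor Y Z g \<Longrightarrow> vfunctor X Z (g \<circ> f)"
  unfolding vfunctor_def by (auto, blast intro: order_trans)

lemma viso_trans:
  assumes "viso X Y" "viso Y Z"
  shows "viso X Z"
proof -
  obtain f g f' g' where *: "vfunctor X Y f" "vfunctor Y X g" "vfunctor Y Z f'" "vfunctor Z Y g'"
    "\<forall>x\<in>ob X. g (f x) = x" "\<forall>y\<in>ob Y. f (g y) = y" "\<forall>y\<in>ob Y. g' (f' y) = y" "\<forall>z\<in>ob Z. f' (g' z) = z"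
    using assms unfolding viso_def by metis
  show ?thesis unfolding viso_def
  proof (intro exI conjI)
    show "vfunctor X Z (f' \<circ> f)" "vfunctor Z X (g \<circ> g')"
      using *(1-4) by (auto intro: vfunctor_comp)
    have "f x \<in> ob Y" if "x \<in> ob X" for x using *(1) that by (simp add: vfunctor_def)
    then show "\<forall>x\<in>ob X. (g \<circ> g') ((f' \<circ> f) x) = x" using *(5,7) by simp
    have "g' z \<in> ob Y" if "z \<in> ob Z" for z using *(4) that by (simp add: vfunctor_def)
    then show "\<forall>z\<in>ob Z. (f' \<circ> f) ((g \<circ> g') z) = z" using *(6,8) by simp
  qed
qed

lemma viso_vtensor:
  assumes "viso X X'" "viso Y Y'"
  shows "viso (vtensor X Y) (vtensor X' Y')"
proof -
  obtain f g f' g' where *: "vfunctor X X' f" "vfunctor X' X g" "vfunctor Y Y' f'" "vfunctor Y' Y g'"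
    "\<forall>x\<in>ob X. g (f x) = x" "\<forall>y\<in>ob X'. f (g y) = y" "\<forall>y\<in>ob Y. g' (f' y) = y" "\<forall>z\<in>ob Y'. f' (g' z) = z"
    using assms unfolding viso_def by metis
  show ?thesis unfolding viso_def
    by (rule exI[of _ "map_prod f f'"], rule exI[of _ "map_prod g g'"])
      (use * in \<open>auto simp: vfunctor_def vtensor_def intro!: mult_mono_quantale\<close>)
qed

lemma GH_mono_viso:
  assumes "viso X X'" "viso Y Y'"
  shows "GH X Y \<le> GH X' Y'"
proof -
  obtain f g f' g' where *: "vfunctor X X' f" "vfunctor X' X g" "vfunctor Y Y' f'" "vfunctor Y' Y g'"
    "\<forall>x\<in>ob X. g (f x) = x" "\<forall>y\<in>ob X'. f (g y) = y" "\<forall>y\<in>ob Y. g' (f' y) = y" "\<forall>z\<in>ob Y'. f' (g' z) = z"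
    using assms unfolding viso_def by metis
  show ?thesis unfolding GH_def
  proof (rule SUP_mono, clarify)
    fix \<phi> assume m: "vmodule X Y \<phi>"
    define \<psi> where "\<psi> x y = \<phi> (g x) (g' y)" for x y
    have g: "g x \<in> ob X" if "x \<in> ob X'" for x using *(2) that by (simp add: vfunctor_def)
    have g': "g' y \<in> ob Y" if "y \<in> ob Y'" for y using *(4) that by (simp add: vfunctor_def)
    have "vmodule X' Y' \<psi>"
      unfolding vmodule_def \<psi>_def
    proof (intro conjI ballI)
      fix x' x y assume a: "x' \<in> ob X'" "x \<in> ob X'" "y \<in> ob Y'"
      have "hom X' x' x * \<phi> (g x) (g' y) \<le> hom X (g x') (g x) * \<phi> (g x) (g' y)"
        using *(2) a by (intro mult_mono_quantale) (simp_all add: vfunctor_def)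
      also have "\<dots> \<le> \<phi> (g x') (g' y)" using m g g' a by (simp add: vmodule_def)
      finally show "hom X' x' x * \<phi> (g x) (g' y) \<le> \<phi> (g x') (g' y)" .
    next
      fix x y y' assume a: "x \<in> ob X'" "y \<in> ob Y'" "y' \<in> ob Y'"
      have "\<phi> (g x) (g' y) * hom Y' y y' \<le> \<phi> (g x) (g' y) * hom Y (g' y) (g' y')"
        using *(4) a by (intro mult_mono_quantale) (simp_all add: vfunctor_def)
      also have "\<dots> \<le> \<phi> (g x) (g' y')" using m g g' a by (simp add: vmodule_def)
      finally show "\<phi> (g x) (g' y) * hom Y' y y' \<le> \<phi> (g x) (g' y')" .
    qed
    moreover have "Htilde \<phi> (ob X) (ob Y) \<le> Htilde \<psi> (ob X') (ob Y')"
      unfolding Htilde_def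
    proof (rule INF_mono)
      fix x assume x: "x \<in> ob X'"
      have "(SUP y\<in>ob Y. \<phi> (g x) y) \<le> (SUP y\<in>ob Y'. \<psi> x y)"
        by (rule SUP_mono) (metis "*"(3) "*"(7) \<psi>_def order_refl vfunctor_def)
      then show "\<exists>x'\<in>ob X. (SUP y\<in>ob Y. \<phi> x' y) \<le> (SUP y\<in>ob Y'. \<psi> x y)"
        using x * unfolding vfunctor_def by blast
    qed
    ultimately show "\<exists>\<psi>\<in>{\<psi>. vmodule X' Y' \<psi>}.
        Htilde \<phi> (ob X) (ob Y) \<le> Htilde \<psi> (ob X') (ob Y')" by blast
  qed
qed

lemma GH_iso_class:
  assumes "small_vcat small X" "small_vcat small Y"
  shows "hom (GH_vcat small) (iso_class small X) (iso_class small Y) = GH X Y"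
proof (rule antisym)
  show "hom (GH_vcat small) (iso_class small X) (iso_class small Y) \<le> GH X Y"
    unfolding GH_vcat_def iso_class_def by (auto intro!: SUP_least GH_mono_viso)
  show "GH X Y \<le> hom (GH_vcat small) (iso_class small X) (iso_class small Y)"
    unfolding GH_vcat_def using assms
    by (simp, intro SUP_upper2[where i = X] SUP_upper2[where i = Y])
      (auto simp: iso_class_def viso_refl)
qed

lemma tensor_iso_class:
  assumes "small_vcat small X" "small_vcat small Y"
  shows "class_tensor small (iso_class small X, iso_class small Y) = iso_class small (vtensor X Y)"
proof
  show "class_tensor small (iso_class small X, iso_class small Y) \<subseteq> iso_class small (vtensor X Y)"
    using viso_trans[OF _ viso_vtensor] unfolding class_tensor_def iso_class_def by fastforce
  show "iso_class small (vtensor X Y) \<subseteq> class_tensor small (iso_class small X, iso_class small Y)"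
    using assms viso_refl[of X] viso_refl[of Y] unfolding class_tensor_def iso_class_def by auto
qed

lemma iso_class_eq_iff:
  assumes "small_vcat small X" "small_vcat small Y"
  shows "iso_class small X = iso_class small Y \<longleftrightarrow> viso X Y"
proof
  have "X \<in> iso_class small X" using assms viso_refl by (simp add: iso_class_def)
  then show "viso X Y" if "iso_class small X = iso_class small Y"
    using that unfolding iso_class_def by blast
  show "iso_class small X = iso_class small Y" if "viso X Y"
    using viso_trans[OF _ that] viso_trans[OF _ viso_sym[OF that]]
    unfolding iso_class_def by blast
qed

lemma small_representative:
  assumes "C \<approx> ob X" "small C" "vcategory X"
  shows "\<exists>Z. small_vcat small Z \<and> viso Z X"
proof -
  obtain h where h: "bij_betw h C (ob X)" using assms(1) unfolding eqpoll_def by blast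
  define Z where "Z = \<lparr>ob = C, hom = (\<lambda>x y. hom X (h x) (h y))\<rparr>"
  have hC: "h x \<in> ob X" if "x \<in> C" for x using h that by (auto simp: bij_betw_def)
  have "small_vcat small Z"
    using assms hC unfolding Z_def small_vcat_def vcategory_def by simp
  moreover have "viso Z X"
    unfolding viso_def
    by (rule exI[of _ h], rule exI[of _ "inv_into C h"])
      (use h hC in \<open>auto simp: vfunctor_def Z_def bij_betw_inv_into_left bij_betw_inv_into_right
        bij_betw_def inv_into_into f_inv_into_f\<close>)
  ultimately show ?thesis by blast
qed

lemma class_tensor_in_GH:
  assumes "universe small" "small_vcat small X" "small_vcat small Y"
  shows "iso_class small (vtensor X Y) \<in> ob (GH_vcat small)"
proof -
  obtain C where C: "small C" "C \<approx> ob X \<times> ob Y"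
    using assms unfolding universe_def small_vcat_def by blast
  have "C \<approx> ob (vtensor X Y)" using C(2) by (simp add: vtensor_def)
  moreover have "vcategory (vtensor X Y)"
    using assms(2,3) by (simp add: vcategory_vtensor small_vcat_def)
  ultimately obtain Z where Z: "small_vcat small Z" "viso Z (vtensor X Y)"
    using small_representative C(1) by blast
  have "iso_class small (vtensor X Y) = iso_class small Z"
    using viso_trans[OF _ Z(2)] viso_trans[OF _ viso_sym[OF Z(2)]]
    unfolding iso_class_def by blast
  then show ?thesis using Z(1) unfolding GH_vcat_def by auto
qed

end

theory Submission
  imports Defs
begin

text \<open>
  All constructions on isomorphism classes are computed on representatives, by
  \<open>GH_iso_class\<close> and \<open>tensor_iso_class\<close>. What remains are statements about individual
  \<V>-categories.

  The category axioms for \<open>GH\<close> come from two modules: the structure \<open>hom X\<close> is itself a module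
  \<open>X \<rightarrow> X\<close> with \<open>1 \<le> Htilde (hom X)\<close>, and the relational composite of modules
  \<open>\<phi> : X \<rightarrow> Y\<close>, \<open>\<psi> : Y \<rightarrow> Z\<close> is a module with
  \<open>Htilde \<phi> * Htilde \<psi> \<le> Htilde (\<phi>;\<psi>)\<close>. That the tensor product is a \<V>-functor comes from the
  pointwise product of modules \<open>\<phi> : X \<rightarrow> X'\<close> and \<open>\<psi> : Y \<rightarrow> Y'\<close>, a module
  \<open>X \<otimes> Y \<rightarrow> X' \<otimes> Y'\<close> whose \<open>Htilde\<close> dominates \<open>Htilde \<phi> * Htilde \<psi>\<close>. In each case the quantale
  distributes the product over the joins defining \<open>Htilde\<close> and \<open>GH\<close>. The monoid laws hold because
  the associativity and unit bijections of cartesian products are isomorphisms of \<V>-categories,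
  which become equalities between isomorphism classes.
\<close>

section \<open>Joins and products in a quantale\<close>

lemma mult_SUP:
  fixes a :: "'v::comm_quantale"
  shows "a * (SUP x\<in>A. f x) = (SUP x\<in>A. a * f x)"
  by (simp add: mult_Sup image_image)

lemma SUP_mult:
  fixes a :: "'v::comm_quantale"
  shows "(SUP x\<in>A. f x) * a = (SUP x\<in>A. f x * a)"
  using mult_SUP[of a f A] by (simp add: mult.commute)

lemma SUP_mult_SUP_le:
  fixes c :: "'v::comm_quantale"
  assumes "\<And>x y. x \<in> A \<Longrightarrow> y \<in> B \<Longrightarrow> f x * g y \<le> c"
  shows "(SUP x\<in>A. f x) * (SUP y\<in>B. g y) \<le> c"
  by (auto simp: SUP_mult mult_SUP intro!: SUP_least assms)

section \<open>Modules and the structure on \<V>-categories\<close>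

lemma Htilde_le_GH: "vmodule X Y \<phi> \<Longrightarrow> Htilde \<phi> (ob X) (ob Y) \<le> GH X Y"
  unfolding GH_def by (rule SUP_upper) simp

lemma vmodule_hom: "vcategory X \<Longrightarrow> vmodule X X (hom X)"
  unfolding vcategory_def vmodule_def by blast

lemma GH_refl:
  assumes "vcategory X"
  shows "1 \<le> GH X X"
proof -
  have "1 \<le> Htilde (hom X) (ob X) (ob X)"
    unfolding Htilde_def using assms
    by (intro INF_greatest) (auto simp: vcategory_def intro: SUP_upper2)
  also have "\<dots> \<le> GH X X"
    by (intro Htilde_le_GH vmodule_hom assms)
  finally show ?thesis .
qed

text \<open>Modules compose like relations, with existential quantification replaced by the join
  over the objects \<open>B\<close> of the middle \<V>-category.\<close>

definition module_comp ::
    "'b set \<Rightarrow> ('a \<Rightarrow> 'b \<Rightarrow> 'v::comm_quantale) \<Rightarrow> ('b \<Rightarrow> 'c \<Rightarrow> 'v) \<Rightarrow> 'a \<Rightarrow> 'c \<Rightarrow> 'v" where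
  "module_comp B \<phi> \<psi> x z = (SUP y\<in>B. \<phi> x y * \<psi> y z)"

lemma vmodule_module_comp:
  assumes "vmodule X Y \<phi>" "vmodule Y Z \<psi>"
  shows "vmodule X Z (module_comp (ob Y) \<phi> \<psi>)"
  unfolding vmodule_def module_comp_def mult_SUP SUP_mult
proof (intro conjI ballI SUP_subset_mono order_refl)
  fix x' x z y assume "x' \<in> ob X" "x \<in> ob X" "z \<in> ob Z" "y \<in> ob Y"
  then have "hom X x' x * \<phi> x y \<le> \<phi> x' y"
    using assms(1) by (simp add: vmodule_def)
  then show "hom X x' x * (\<phi> x y * \<psi> y z) \<le> \<phi> x' y * \<psi> y z"
    using mult_mono_quantale[OF _ order_refl] by (simp add: mult.assoc[symmetric])
next
  fix x z z' y assume "x \<in> ob X" "z \<in> ob Z" "z' \<in> ob Z" "y \<in> ob Y"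
  then have "\<psi> y z * hom Z z z' \<le> \<psi> y z'"
    using assms(2) by (simp add: vmodule_def)
  then show "\<phi> x y * \<psi> y z * hom Z z z' \<le> \<phi> x y * \<psi> y z'"
    using mult_mono_quantale[OF order_refl] by (simp add: mult.assoc)
qed

lemma Htilde_module_comp:
  "Htilde \<phi> A B * Htilde \<psi> B C \<le> Htilde (module_comp B \<phi> \<psi>) A C"
  unfolding Htilde_def[of "module_comp B \<phi> \<psi>"]
proof (rule INF_greatest)
  fix x assume x: "x \<in> A"
  have "Htilde \<phi> A B * Htilde \<psi> B C \<le> (SUP y\<in>B. \<phi> x y) * Htilde \<psi> B C"
    unfolding Htilde_def[of \<phi>] by (intro mult_mono_quantale INF_lower x order_refl)
  also have "\<dots> = (SUP y\<in>B. \<phi> x y * Htilde \<psi> B C)"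
    by (rule SUP_mult)
  also have "\<dots> \<le> (SUP z\<in>C. module_comp B \<phi> \<psi> x z)"
  proof (rule SUP_least)
    fix y assume y: "y \<in> B"
    have "\<phi> x y * Htilde \<psi> B C \<le> \<phi> x y * (SUP z\<in>C. \<psi> y z)"
      unfolding Htilde_def by (intro mult_mono_quantale INF_lower y order_refl)
    also have "\<dots> = (SUP z\<in>C. \<phi> x y * \<psi> y z)"
      by (rule mult_SUP)
    also have "\<dots> \<le> (SUP z\<in>C. module_comp B \<phi> \<psi> x z)"
      unfolding module_comp_def by (intro SUP_subset_mono order_refl SUP_upper y)
    finally show "\<phi> x y * Htilde \<psi> B C \<le> (SUP z\<in>C. module_comp B \<phi> \<psi> x z)" .
  qed
  finally show "Htilde \<phi> A B * Htilde \<psi> B C \<le> (SUP z\<in>C. module_comp B \<phi> \<psi> x z)" .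
qed

lemma GH_trans: "GH X Y * GH Y Z \<le> GH X Z"
  unfolding GH_def[of X Y] GH_def[of Y Z]
proof (rule SUP_mult_SUP_le, clarify)
  fix \<phi> \<psi> assume "vmodule X Y \<phi>" "vmodule Y Z \<psi>"
  then show "Htilde \<phi> (ob X) (ob Y) * Htilde \<psi> (ob Y) (ob Z) \<le> GH X Z"
    by (blast intro: order_trans Htilde_module_comp Htilde_le_GH vmodule_module_comp)
qed

text \<open>The tensor product of modules, given by pointwise multiplication.\<close>

definition module_tensor :: "('a \<Rightarrow> 'c \<Rightarrow> 'v::comm_quantale) \<Rightarrow> ('b \<Rightarrow> 'd \<Rightarrow> 'v) \<Rightarrow>
    'a \<times> 'b \<Rightarrow> 'c \<times> 'd \<Rightarrow> 'v" where
  "module_tensor \<phi> \<psi> p q = \<phi> (fst p) (fst q) * \<psi> (snd p) (snd q)"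

lemma mult_mono_interchange:
  fixes a b c d :: "'v::comm_quantale"
  assumes "a * b \<le> e" "c * d \<le> f"
  shows "(a * c) * (b * d) \<le> e * f"
  using mult_mono_quantale[OF assms] by (simp add: ac_simps)

lemma vmodule_module_tensor:
  assumes "vmodule X X' \<phi>" "vmodule Y Y' \<psi>"
  shows "vmodule (vtensor X Y) (vtensor X' Y') (module_tensor \<phi> \<psi>)"
  using assms unfolding vmodule_def vtensor_def module_tensor_def
  by (auto intro!: mult_mono_interchange)

lemma Htilde_module_tensor:
  "Htilde \<phi> A C * Htilde \<psi> B D \<le> Htilde (module_tensor \<phi> \<psi>) (A \<times> B) (C \<times> D)"
  unfolding Htilde_def[of "module_tensor \<phi> \<psi>"]
proof (rule INF_greatest, clarify)
  fix x y assume "x \<in> A" "y \<in> B"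
  then have "Htilde \<phi> A C * Htilde \<psi> B D \<le> (SUP x'\<in>C. \<phi> x x') * (SUP y'\<in>D. \<psi> y y')"
    unfolding Htilde_def by (intro mult_mono_quantale INF_lower)
  also have "\<dots> \<le> (SUP q\<in>C \<times> D. module_tensor \<phi> \<psi> (x, y) q)"
  proof (rule SUP_mult_SUP_le)
    fix x' y' assume "x' \<in> C" "y' \<in> D"
    then show "\<phi> x x' * \<psi> y y' \<le> (SUP q\<in>C \<times> D. module_tensor \<phi> \<psi> (x, y) q)"
      by (intro SUP_upper2[where i = "(x', y')"]) (simp_all add: module_tensor_def)
  qed
  finally show "Htilde \<phi> A C * Htilde \<psi> B D \<le> (SUP q\<in>C \<times> D. module_tensor \<phi> \<psi> (x, y) q)" .
qed

lemma GH_vtensor: "GH X X' * GH Y Y' \<le> GH (vtensor X Y) (vtensor X' Y')"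
  unfolding GH_def[of X X'] GH_def[of Y Y']
proof (rule SUP_mult_SUP_le, clarify)
  fix \<phi> \<psi> assume "vmodule X X' \<phi>" "vmodule Y Y' \<psi>"
  then have "Htilde (module_tensor \<phi> \<psi>) (ob (vtensor X Y)) (ob (vtensor X' Y'))
      \<le> GH (vtensor X Y) (vtensor X' Y')"
    by (intro Htilde_le_GH vmodule_module_tensor)
  moreover have "Htilde \<phi> (ob X) (ob X') * Htilde \<psi> (ob Y) (ob Y')
      \<le> Htilde (module_tensor \<phi> \<psi>) (ob (vtensor X Y)) (ob (vtensor X' Y'))"
    using Htilde_module_tensor by (simp add: vtensor_def)
  ultimately show "Htilde \<phi> (ob X) (ob X') * Htilde \<psi> (ob Y) (ob Y')
      \<le> GH (vtensor X Y) (vtensor X' Y')"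
    by (rule order_trans[rotated])
qed

section \<open>Coherence isomorphisms\<close>

lemma viso_assoc: "viso (vtensor (vtensor X Y) Z) (vtensor X (vtensor Y Z))"
  unfolding viso_def
  by (rule exI[of _ vassoc], rule exI[of _ "\<lambda>q. ((fst q, fst (snd q)), snd (snd q))"])
    (auto simp: vfunctor_def vtensor_def vassoc_def mult.assoc)

lemma viso_unit_left: "viso (vtensor vunit X) X"
  unfolding viso_def
  by (rule exI[of _ snd], rule exI[of _ "Pair ()"])
    (auto simp: vfunctor_def vtensor_def vunit_def)

lemma viso_unit_right: "viso (vtensor X vunit) X"
  unfolding viso_def
  by (rule exI[of _ fst], rule exI[of _ "\<lambda>x. (x, ())"])
    (auto simp: vfunctor_def vtensor_def vunit_def)

section \<open>Isomorphism classes\<close>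

text \<open>
  Unlike in \<open>iso_class_eq_iff\<close>, the two \<V>-categories may live on different types, so this applies
  to tensor products and to the unit.
\<close>

lemma iso_class_cong:
  assumes "viso X Y"
  shows "iso_class small X = iso_class small Y"
  using viso_trans[OF _ assms] viso_trans[OF _ viso_sym[OF assms]]
  unfolding iso_class_def by blast

lemma ob_GH_vcat_iff:
  "C \<in> ob (GH_vcat small) \<longleftrightarrow> (\<exists>X. small_vcat small X \<and> C = iso_class small X)"
  unfolding GH_vcat_def by auto

lemma ob_GH_vcatE:
  assumes "C \<in> ob (GH_vcat small)"
  obtains X where "small_vcat small X" "C = iso_class small X"
  using assms unfolding ob_GH_vcat_iff by blast

lemma small_vtensor:
  fixes X Y :: "('u, 'v::comm_quantale) vcat"
  assumes "universe small" "small_vcat small X" "small_vcat small Y"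
  obtains W :: "('u, 'v) vcat" where "small_vcat small W" "viso W (vtensor X Y)"
proof -
  obtain W :: "('u, 'v) vcat" where W: "small_vcat small W"
      "iso_class small (vtensor X Y) = iso_class small W"
    using class_tensor_in_GH[OF assms] by (rule ob_GH_vcatE)
  moreover have "W \<in> iso_class small W"
    using W(1) by (simp add: iso_class_def viso_refl)
  ultimately have "W \<in> iso_class small (vtensor X Y)"
    by simp
  then have "viso W (vtensor X Y)"
    by (simp add: iso_class_def)
  with W(1) show thesis by (rule that)
qed

lemma small_vunit:
  fixes small :: "'u set \<Rightarrow> bool"
  assumes "universe small"
  obtains U :: "('u, 'v::comm_quantale) vcat" where "small_vcat small U" "viso U vunit"
proof -
  obtain A and a :: 'u where "small A" "a \<in> A"
    using assms unfolding universe_def by blast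
  moreover have "{a} \<lesssim> A"
    using \<open>a \<in> A\<close> by (intro subset_imp_lepoll) simp
  ultimately have "small {a}"
    using assms unfolding universe_def by blast
  moreover have "{a} \<approx> ob (vunit :: (unit, 'v) vcat)"
    by (simp add: vunit_def singleton_eqpoll)
  moreover have "vcategory (vunit :: (unit, 'v) vcat)"
    by (simp add: vcategory_def vunit_def)
  ultimately show thesis
    using small_representative that by blast
qed

text \<open>
  The tensor of classes may be computed with any \<V>-categories isomorphic to small ones, whatever
  their types.
\<close>

lemma class_tensor_viso:
  assumes "small_vcat small W" "viso W X" "small_vcat small W'" "viso W' Y"
  shows "class_tensor small (iso_class small X, iso_class small Y)
    = iso_class small (vtensor X Y)"
  using tensor_iso_class[OF assms(1,3)] iso_class_cong[of _ _ small, OF assms(2)] iso_class_cong[of _ _ small, OF assms(4)]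
    iso_class_cong[of _ _ small, OF viso_vtensor[OF assms(2,4)]]
  by simp

lemma vcategory_GH_vcat: "vcategory (GH_vcat small)"
  unfolding vcategory_def
  by (auto elim!: ob_GH_vcatE simp: GH_iso_class small_vcat_def intro: GH_refl GH_trans)

lemma vfunctor_class_tensor:
  fixes small :: "'u set \<Rightarrow> bool"
  assumes "universe small"
  shows "vfunctor (vtensor (GH_vcat small) (GH_vcat small))
    (GH_vcat small :: (('u, 'v::comm_quantale) vcat set, 'v) vcat) (class_tensor small)"
  unfolding vfunctor_def
proof (intro conjI ballI)
  fix p :: "('u, 'v) vcat set \<times> ('u, 'v) vcat set"
  assume "p \<in> ob (vtensor (GH_vcat small) (GH_vcat small))"
  then obtain X Y where "small_vcat small X" "small_vcat small Y"
    and "p = (iso_class small X, iso_class small Y)"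
    by (auto simp: vtensor_def elim!: ob_GH_vcatE)
  then show "class_tensor small p \<in> ob (GH_vcat small)"
    using class_tensor_in_GH[OF assms] by (simp add: tensor_iso_class)
next
  fix p q :: "('u, 'v) vcat set \<times> ('u, 'v) vcat set"
  assume "p \<in> ob (vtensor (GH_vcat small) (GH_vcat small))"
  then obtain X Y where X: "small_vcat small X" and Y: "small_vcat small Y"
    and p: "p = (iso_class small X, iso_class small Y)"
    by (auto simp: vtensor_def elim!: ob_GH_vcatE)
  assume "q \<in> ob (vtensor (GH_vcat small) (GH_vcat small))"
  then obtain X' Y' where X': "small_vcat small X'" and Y': "small_vcat small Y'"
    and q: "q = (iso_class small X', iso_class small Y')"
    by (auto simp: vtensor_def elim!: ob_GH_vcatE)
  \<comment> \<open>\<open>GH_iso_class\<close> needs representatives on the base type.\<close>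
  obtain W where W: "small_vcat small W" "viso W (vtensor X Y)"
    using assms X Y by (rule small_vtensor)
  obtain W' where W': "small_vcat small W'" "viso W' (vtensor X' Y')"
    using assms X' Y' by (rule small_vtensor)
  have "hom (vtensor (GH_vcat small) (GH_vcat small)) p q = GH X X' * GH Y Y'"
    using X Y X' Y' by (simp add: p q vtensor_def GH_iso_class)
  also have "\<dots> \<le> GH (vtensor X Y) (vtensor X' Y')"
    by (rule GH_vtensor)
  also have "\<dots> \<le> GH W W'"
    using W(2) W'(2) by (rule GH_mono_viso[OF viso_sym viso_sym])
  also have "\<dots> = hom (GH_vcat small) (iso_class small W) (iso_class small W')"
    using W(1) W'(1) by (simp add: GH_iso_class)
  also have "iso_class small W = class_tensor small p"
    using iso_class_cong[of _ _ small, OF W(2)] X Y by (simp add: p tensor_iso_class)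
  also have "iso_class small W' = class_tensor small q"
    using iso_class_cong[of _ _ small, OF W'(2)] X' Y' by (simp add: q tensor_iso_class)
  finally show "hom (vtensor (GH_vcat small) (GH_vcat small)) p q
      \<le> hom (GH_vcat small) (class_tensor small p) (class_tensor small q)" .
qed

lemma vfunctor_class_unit:
  fixes small :: "'u set \<Rightarrow> bool"
  assumes "universe small"
  shows "vfunctor vunit (GH_vcat small :: (('u, 'v::comm_quantale) vcat set, 'v) vcat)
    (class_unit small)"
proof -
  obtain U :: "('u, 'v) vcat" where U: "small_vcat small U" "viso U vunit"
    using assms by (rule small_vunit)
  let ?G = "GH_vcat small :: (('u, 'v) vcat set, 'v) vcat"
  have "class_unit small u \<in> ob ?G" for u
    unfolding class_unit_def ob_GH_vcat_iff using U iso_class_cong by metis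
  moreover have "vcategory ?G"
    by (rule vcategory_GH_vcat)
  ultimately show ?thesis
    by (simp add: vfunctor_def vcategory_def vunit_def)
qed

lemma class_tensor_assoc:
  fixes X Y Z :: "('u, 'v::comm_quantale) vcat"
  assumes "universe small" "small_vcat small X" "small_vcat small Y" "small_vcat small Z"
  shows "class_tensor small (class_tensor small (iso_class small X, iso_class small Y),
      iso_class small Z)
    = class_tensor small (iso_class small X,
      class_tensor small (iso_class small Y, iso_class small Z))"
proof -
  obtain W :: "('u, 'v) vcat" where W: "small_vcat small W" "viso W (vtensor X Y)"
    using assms(1-3) by (rule small_vtensor)
  obtain V :: "('u, 'v) vcat" where V: "small_vcat small V" "viso V (vtensor Y Z)"
    using assms(1,3,4) by (rule small_vtensor)
  show ?thesis
    using class_tensor_viso[OF W assms(4) viso_refl] class_tensor_viso[OF assms(2) viso_refl V]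
      iso_class_cong[of _ _ small, OF viso_assoc[of X Y Z]] assms(2-4)
    by (simp add: tensor_iso_class)
qed

lemma class_tensor_unit:
  fixes X :: "('u, 'v::comm_quantale) vcat"
  assumes "universe small" "small_vcat small X"
  shows "class_tensor small (class_unit small u, iso_class small X) = iso_class small X"
    and "class_tensor small (iso_class small X, class_unit small u) = iso_class small X"
proof -
  obtain U :: "('u, 'v) vcat" where U: "small_vcat small U" "viso U vunit"
    using assms(1) by (rule small_vunit)
  show "class_tensor small (class_unit small u, iso_class small X) = iso_class small X"
    using class_tensor_viso[OF U assms(2) viso_refl] iso_class_cong[of _ _ small, OF viso_unit_left[of X]]
    by (simp add: class_unit_def)
  show "class_tensor small (iso_class small X, class_unit small u) = iso_class small X"
    using class_tensor_viso[OF assms(2) viso_refl U] iso_class_cong[of _ _ small, OF viso_unit_right[of X]]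
    by (simp add: class_unit_def)
qed

theorem proposition4:
  fixes small :: "'u set \<Rightarrow> bool"
  assumes "universe small"
  shows "monoid_in_VCAT (GH_vcat small :: (('u, 'v::comm_quantale) vcat set, 'v) vcat)
           (class_tensor small) (class_unit small)"
  unfolding monoid_in_VCAT_def
proof (intro conjI)
  let ?G = "GH_vcat small :: (('u, 'v) vcat set, 'v) vcat"
  show "vcategory ?G" by (rule vcategory_GH_vcat)
  show "vfunctor (vtensor ?G ?G) ?G (class_tensor small)"
    using assms by (rule vfunctor_class_tensor)
  show "vfunctor vunit ?G (class_unit small)"
    using assms by (rule vfunctor_class_unit)
  show "\<forall>p\<in>ob (vtensor (vtensor ?G ?G) ?G).
      (class_tensor small \<circ> map_prod (class_tensor small) id) p
      = (class_tensor small \<circ> map_prod id (class_tensor small) \<circ> vassoc) p"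
    by (auto simp: vtensor_def vassoc_def class_tensor_assoc[OF assms] elim!: ob_GH_vcatE)
  show "\<forall>p\<in>ob (vtensor vunit ?G).
      (class_tensor small \<circ> map_prod (class_unit small) id) p = snd p"
    by (auto simp: vtensor_def class_tensor_unit[OF assms] elim!: ob_GH_vcatE)
  show "\<forall>p\<in>ob (vtensor ?G vunit).
      (class_tensor small \<circ> map_prod id (class_unit small)) p = fst p"
    by (auto simp: vtensor_def class_tensor_unit[OF assms] elim!: ob_GH_vcatE)
qed

end
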